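(* Let $\mathcal A$ be a countable alphabet with a degree map $\deg:\mathcal A\to\mathbb Z_{\ge1}$ such that only finitely many letters have each degree, and let $(\mathrm{Lie}(\mathcal A),[\cdot,\cdot],\triangleright)$ be a post-Lie algebra (with $[\cdot,\cdot]$ the usual bracket of the free Lie algebra) such that $\triangleright$ is homogeneous for the induced grading. Let $\circledast$ be the associated Grossman–Larson product on $\mathbb Q\langle\mathcal A\rangle$ and $\Delta_\circledast$ its dual coproduct. Then for every word $A\in\mathcal A^*$, \[ \Delta_\circledast(A)=\sum_{n\ge1}\ \sum_{A=A_1\cdots A_n}(A_1\otimes\mathbf 1)⧢_\bullet\triangleleft^{\mathrm{irr}}(A_2)⧢_\bullet\cdots⧢_\bullet\triangleleft^{\mathrm{irr}}(A_n), \] where the inner sum runs over all factorizations of $A$ into (possibly empty) subwords $A_1,\dots,A_n$.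
   Context: $\mathcal A^*$ is the set of words in $\mathcal A$ including the empty word $\mathbf 1$; $\mathbb Q\langle\mathcal A\rangle$ is the free associative algebra (concatenation) and $\mathrm{Lie}(\mathcal A)\subset\mathbb Q\langle\mathcal A\rangle$ the free Lie algebra, via $[u,w]=uw-wu$. $\mathbb Q\langle\mathcal A\rangle$ with concatenation and the shuffle coproduct $\Delta$ (multiplicative, $\Delta(a)=a\otimes\mathbf1+\mathbf1\otimes a$ for letters $a$; Sweedler notation $\Delta(A)=A_{(1)}\otimes A_{(2)}$) is the universal enveloping algebra of $\mathrm{Lie}(\mathcal A)$. A post-Lie algebra is a Lie algebra $(\mathfrak g,[\cdot,\cdot])$ with bilinear $\triangleright$ satisfying $x\triangleright[y,z]=[x\triangleright y,z]+[y,x\triangleright z]$ and $[x,y]\triangleright z=x\triangleright(y\triangleright z)-(x\triangleright y)\triangleright z-y\triangleright(x\triangleright z)+(y\triangleright x)\triangleright z$. The product $\triangleright$ extends uniquely to $\mathbb Q\langle\mathcal A\rangle\otimes\mathbb Q\langle\mathcal A\rangle\to\mathbb Q\langle\mathcal A\rangle$ by $x\triangleright\mathbf1=0$, $\mathbf1\triangleright A=A$, $xA\triangleright y=x\triangleright(A\triangleright y)-(x\triangleright A)\triangleright y$, $A\triangleright BC=(A_{(1)}\triangleright B)(A_{(2)}\triangleright C)$ ($x,y\in\mathrm{Lie}(\mathcal A)$). The Grossman–Larson product is $A\circledast B=A_{(1)}(A_{(2)}\triangleright B)$. The pairing $(-\mid-)$ on $\mathbb Q\langle\mathcal A\rangle$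 is the bilinear form for which words are orthonormal; $\Delta_\circledast$ is defined by $(A\circledast B\mid C)=(A\otimes B\mid\Delta_\circledast(C))$ and $\triangleleft$ by $(A\triangleright B\mid C)=(A\otimes B\mid\triangleleft(C))$. The reduced cotriangle map is $\triangleleft^{\mathrm{irr}}(A)=\sum_{w\in\mathcal A^*,\,a\in\mathcal A}(w\otimes a\mid\triangleleft(A))\,w\otimes a$. The shuffle product $⧢$ is given by $\mathbf1⧢A=A⧢\mathbf1=A$ and $xA⧢yB=x(A⧢yB)+y(xA⧢B)$ for letters $x,y$. Finally $(A_1\otimes A_2)⧢_\bullet(B_1\otimes B_2)=(A_1⧢B_1)\otimes(A_2B_2)$ on $\mathbb Q\langle\mathcal A\rangle^{\otimes2}$. *)

theory Defs
  imports Complex_Main "HOL-Library.Poly_Mapping" "HOL-Library.Product_Plus"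
    "HOL-Library.Countable"
begin

text \<open>
  Words over the alphabet \<open>'a\<close> are lists.  Concatenation is registered as the (noncommutative)
  additive monoid structure of lists, so that the convolution product of \<^theory>\<open>HOL-Library.Poly_Mapping\<close>
  turns finitely supported functions on words into the free associative algebra: \<open>*\<close> is the
  concatenation product and \<open>1\<close> is the empty word.
\<close>

instantiation list :: (type) monoid_add
begin

definition zero_list :: "'a list" where "zero_list = []"

definition plus_list :: "'a list \<Rightarrow> 'a list \<Rightarrow> 'a list" where "plus_list u v = u @ v"

instance by standard (simp_all add: zero_list_def plus_list_def)

end

type_synonym 'a free_alg = "'a list \<Rightarrow>\<^sub>0 rat"

text \<open>
  The tensor square, with basis the pairs \<open>(u, v)\<close> standing for \<open>u \<otimes> v\<close>.  Pairs of words are added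
  componentwise, so \<open>*\<close> is the product \<open>(a \<otimes> b) * (c \<otimes> d) = (a * c) \<otimes> (b * d)\<close>.
\<close>

type_synonym 'a free_alg2 = "('a list \<times> 'a list) \<Rightarrow>\<^sub>0 rat"

definition scl :: "rat \<Rightarrow> ('k \<Rightarrow>\<^sub>0 rat) \<Rightarrow> ('k \<Rightarrow>\<^sub>0 rat)" where
  "scl c p = Poly_Mapping.map ((*) c) p"

lemma lookup_scl [simp]: "Poly_Mapping.lookup (scl c p) k = c * Poly_Mapping.lookup p k"
  by (simp add: scl_def Poly_Mapping.map.rep_eq when_def)

global_interpretation free_module: vector_space "scl :: rat \<Rightarrow> ('k \<Rightarrow>\<^sub>0 rat) \<Rightarrow> ('k \<Rightarrow>\<^sub>0 rat)"
  by standard (auto intro!: poly_mapping_eqI simp: lookup_add algebra_simps)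

definition word :: "'k \<Rightarrow> ('k \<Rightarrow>\<^sub>0 rat)" where
  "word w = Poly_Mapping.single w 1"

text \<open>The linear map with prescribed values on basis elements.\<close>

definition lin_ext :: "('k \<Rightarrow> ('l \<Rightarrow>\<^sub>0 rat)) \<Rightarrow> ('k \<Rightarrow>\<^sub>0 rat) \<Rightarrow> ('l \<Rightarrow>\<^sub>0 rat)" where
  "lin_ext f p = (\<Sum>k\<in>Poly_Mapping.keys p. scl (Poly_Mapping.lookup p k) (f k))"

definition tensor :: "'a free_alg \<Rightarrow> 'a free_alg \<Rightarrow> 'a free_alg2" (infixr "\<otimes>" 75) where
  "A \<otimes> B = lin_ext (\<lambda>u. lin_ext (\<lambda>v. word (u, v)) B) A"

text \<open>The linear map on the tensor square induced by a bilinear map \<open>F\<close>; it sends \<open>A \<otimes> B\<close> to \<open>F A B\<close>.\<close>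

definition tensor_lift :: "('a free_alg \<Rightarrow> 'a free_alg \<Rightarrow> 'a free_alg) \<Rightarrow> 'a free_alg2 \<Rightarrow> 'a free_alg"
  where "tensor_lift F = lin_ext (\<lambda>(u, v). F (word u) (word v))"

definition pairing :: "('k \<Rightarrow>\<^sub>0 rat) \<Rightarrow> ('k \<Rightarrow>\<^sub>0 rat) \<Rightarrow> rat" where
  "pairing p q = (\<Sum>k\<in>Poly_Mapping.keys p. Poly_Mapping.lookup p k * Poly_Mapping.lookup q k)"

definition comm :: "'a free_alg \<Rightarrow> 'a free_alg \<Rightarrow> 'a free_alg" where
  "comm u w = u * w - w * u"

text \<open>The free Lie algebra: the smallest Lie subalgebra containing the letters.\<close>

inductive_set Lie :: "'a free_alg set" where
  letter: "word [a] \<in> Lie"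
| zero: "0 \<in> Lie"
| add: "x \<in> Lie \<Longrightarrow> y \<in> Lie \<Longrightarrow> x + y \<in> Lie"
| scale: "x \<in> Lie \<Longrightarrow> scl c x \<in> Lie"
| bracket: "x \<in> Lie \<Longrightarrow> y \<in> Lie \<Longrightarrow> comm x y \<in> Lie"

text \<open>\<open>f\<close> restricts to a bilinear map \<open>g \<times> g \<rightarrow> g\<close>.\<close>

definition bilinear_on :: "('k \<Rightarrow>\<^sub>0 rat) set \<Rightarrow>
    (('k \<Rightarrow>\<^sub>0 rat) \<Rightarrow> ('k \<Rightarrow>\<^sub>0 rat) \<Rightarrow> ('k \<Rightarrow>\<^sub>0 rat)) \<Rightarrow> bool" where
  "bilinear_on g f \<longleftrightarrow>
     (\<forall>x\<in>g. \<forall>y\<in>g. f x y \<in> g) \<and>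
     (\<forall>x\<in>g. \<forall>y\<in>g. \<forall>z\<in>g. f (x + y) z = f x z + f y z \<and> f x (y + z) = f x y + f x z) \<and>
     (\<forall>x\<in>g. \<forall>y\<in>g. \<forall>c. f (scl c x) y = scl c (f x y) \<and> f x (scl c y) = scl c (f x y))"

definition lie_algebra :: "('k \<Rightarrow>\<^sub>0 rat) set \<Rightarrow>
    (('k \<Rightarrow>\<^sub>0 rat) \<Rightarrow> ('k \<Rightarrow>\<^sub>0 rat) \<Rightarrow> ('k \<Rightarrow>\<^sub>0 rat)) \<Rightarrow> bool" where
  "lie_algebra g br \<longleftrightarrow>
     free_module.subspace g \<and> bilinear_on g br \<and>
     (\<forall>x\<in>g. br x x = 0) \<and>
     (\<forall>x\<in>g. \<forall>y\<in>g. \<forall>z\<in>g. br x (br y z) + br y (br z x) + br z (br x y) = 0)"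

definition post_lie_algebra :: "('k \<Rightarrow>\<^sub>0 rat) set \<Rightarrow>
    (('k \<Rightarrow>\<^sub>0 rat) \<Rightarrow> ('k \<Rightarrow>\<^sub>0 rat) \<Rightarrow> ('k \<Rightarrow>\<^sub>0 rat)) \<Rightarrow>
    (('k \<Rightarrow>\<^sub>0 rat) \<Rightarrow> ('k \<Rightarrow>\<^sub>0 rat) \<Rightarrow> ('k \<Rightarrow>\<^sub>0 rat)) \<Rightarrow> bool" where
  "post_lie_algebra g br tri \<longleftrightarrow>
     lie_algebra g br \<and> bilinear_on g tri \<and>
     (\<forall>x\<in>g. \<forall>y\<in>g. \<forall>z\<in>g. tri x (br y z) = br (tri x y) z + br y (tri x z)) \<and>
     (\<forall>x\<in>g. \<forall>y\<in>g. \<forall>z\<in>g. tri (br x y) z =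
        tri x (tri y z) - tri (tri x y) z - tri y (tri x z) + tri (tri y x) z)"

text \<open>Homogeneity for the grading of words by the sum of the degrees of their letters.\<close>

definition homogeneous :: "('a \<Rightarrow> nat) \<Rightarrow> nat \<Rightarrow> 'a free_alg \<Rightarrow> bool" where
  "homogeneous deg n p \<longleftrightarrow> (\<forall>w\<in>Poly_Mapping.keys p. sum_list (map deg w) = n)"

definition homogeneous_product_on :: "('a \<Rightarrow> nat) \<Rightarrow> 'a free_alg set \<Rightarrow>
    ('a free_alg \<Rightarrow> 'a free_alg \<Rightarrow> 'a free_alg) \<Rightarrow> bool" where
  "homogeneous_product_on deg g f \<longleftrightarrow>
     (\<forall>x\<in>g. \<forall>y\<in>g. \<forall>m n. homogeneous deg m x \<longrightarrow> homogeneous deg n y \<longrightarrow>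
        homogeneous deg (m + n) (f x y))"

text \<open>The shuffle coproduct: the algebra morphism with \<open>a \<mapsto> a \<otimes> 1 + 1 \<otimes> a\<close> for letters \<open>a\<close>.\<close>

definition coprod :: "'a free_alg \<Rightarrow> 'a free_alg2" where
  "coprod = lin_ext (\<lambda>w. prod_list (map (\<lambda>a. word [a] \<otimes> 1 + 1 \<otimes> word [a]) w))"

text \<open>
  \<open>T\<close> is the extension of the post-Lie product \<open>tri\<close> to the whole free algebra.  These rules
  determine \<open>T\<close> uniquely.  In the last one, \<open>tensor_lift _ (coprod A)\<close> renders the Sweedler sum
  \<open>(A\<^sub>(\<^sub>1\<^sub>) \<triangleright> B) (A\<^sub>(\<^sub>2\<^sub>) \<triangleright> C)\<close>.
\<close>

definition post_lie_extension :: "('a free_alg \<Rightarrow> 'a free_alg \<Rightarrow> 'a free_alg) \<Rightarrow>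
    ('a free_alg \<Rightarrow> 'a free_alg \<Rightarrow> 'a free_alg) \<Rightarrow> bool" where
  "post_lie_extension tri T \<longleftrightarrow>
     bilinear_on UNIV T \<and>
     (\<forall>x\<in>Lie. \<forall>y\<in>Lie. T x y = tri x y) \<and>
     (\<forall>x\<in>Lie. T x 1 = 0) \<and>
     (\<forall>A. T 1 A = A) \<and>
     (\<forall>x\<in>Lie. \<forall>A. \<forall>y\<in>Lie. T (x * A) y = T x (T A y) - T (T x A) y) \<and>
     (\<forall>A B C. T A (B * C) = tensor_lift (\<lambda>P Q. T P B * T Q C) (coprod A))"

definition grossman_larson :: "('a free_alg \<Rightarrow> 'a free_alg \<Rightarrow> 'a free_alg) \<Rightarrow>
    'a free_alg \<Rightarrow> 'a free_alg \<Rightarrow> 'a free_alg" where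
  "grossman_larson T A B = tensor_lift (\<lambda>P Q. P * T Q B) (coprod A)"

text \<open>
  The dual of a bilinear product.  The adjoint tensor is unique whenever it exists.
\<close>

definition dual_coprod :: "('a free_alg \<Rightarrow> 'a free_alg \<Rightarrow> 'a free_alg) \<Rightarrow>
    'a free_alg \<Rightarrow> 'a free_alg2" where
  "dual_coprod F C = (THE X. \<forall>A B. pairing (F A B) C = pairing (A \<otimes> B) X)"

definition coprod_GL :: "('a free_alg \<Rightarrow> 'a free_alg \<Rightarrow> 'a free_alg) \<Rightarrow>
    'a free_alg \<Rightarrow> 'a free_alg2" where
  "coprod_GL T = dual_coprod (grossman_larson T)"

definition cotriangle :: "('a free_alg \<Rightarrow> 'a free_alg \<Rightarrow> 'a free_alg) \<Rightarrow>
    'a free_alg \<Rightarrow> 'a free_alg2" where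
  "cotriangle T = dual_coprod T"

definition cotriangle_irr :: "('a free_alg \<Rightarrow> 'a free_alg \<Rightarrow> 'a free_alg) \<Rightarrow>
    'a free_alg \<Rightarrow> 'a free_alg2" where
  "cotriangle_irr T A = Sum_any (\<lambda>(w, a).
     scl (pairing (word w \<otimes> word [a]) (cotriangle T A)) (word w \<otimes> word [a]))"

fun shuffle_words :: "'a list \<Rightarrow> 'a list \<Rightarrow> 'a free_alg" where
  "shuffle_words [] v = word v"
| "shuffle_words u [] = word u"
| "shuffle_words (x # u) (y # v) =
     word [x] * shuffle_words u (y # v) + word [y] * shuffle_words (x # u) v"

definition shuffle :: "'a free_alg \<Rightarrow> 'a free_alg \<Rightarrow> 'a free_alg" where
  "shuffle A B = lin_ext (\<lambda>u. lin_ext (\<lambda>v. shuffle_words u v) B) A"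

text \<open>The bilinear product with \<open>(A\<^sub>1 \<otimes> A\<^sub>2, B\<^sub>1 \<otimes> B\<^sub>2) \<mapsto> shuffle A\<^sub>1 B\<^sub>1 \<otimes> (A\<^sub>2 * B\<^sub>2)\<close>.\<close>

definition shuffle_bullet :: "'a free_alg2 \<Rightarrow> 'a free_alg2 \<Rightarrow> 'a free_alg2" where
  "shuffle_bullet X Y = lin_ext (\<lambda>(u, u'). lin_ext (\<lambda>(v, v').
     shuffle (word u) (word v) \<otimes> (word u' * word v')) Y) X"

text \<open>
  For a factorization \<open>ws = [A\<^sub>1, \<dots>, A\<^sub>n]\<close> with \<open>n \<ge> 1\<close>: the product (an associative one)
  of \<open>A\<^sub>1 \<otimes> 1\<close> and the reduced cotriangles of \<open>A\<^sub>2, \<dots>, A\<^sub>n\<close>.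
\<close>

definition factorization_term :: "('a free_alg \<Rightarrow> 'a free_alg \<Rightarrow> 'a free_alg) \<Rightarrow>
    'a list list \<Rightarrow> 'a free_alg2" where
  "factorization_term T ws =
     foldl shuffle_bullet (word (hd ws) \<otimes> 1) (map (\<lambda>w. cotriangle_irr T (word w)) (tl ws))"

text \<open>Factorizations of \<open>A\<close> into \<open>n\<close> possibly empty words.\<close>

definition factorizations :: "nat \<Rightarrow> 'a list \<Rightarrow> 'a list list set" where
  "factorizations n A = {ws. length ws = n \<and> concat ws = A}"

end

theory Submission
  imports Defs
begin

text \<open>
  Write a word as \<open>v = a\<^sub>1 \<dots> a\<^sub>k\<close>.  Since \<open>u \<triangleright> -\<close> distributes over concatenation through the shuffle
  coproduct, coassociativity gives
  \<open>u \<circledast> v = u\<^sub>(\<^sub>1\<^sub>) (u\<^sub>(\<^sub>2\<^sub>) \<triangleright> a\<^sub>1) \<dots> (u\<^sub>(\<^sub>k\<^sub>+\<^sub>1\<^sub>) \<triangleright> a\<^sub>k)\<close>.  Pairing with \<open>A\<close> splits \<open>A\<close> into \<open>k + 1\<close>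
  factors, and since the shuffle product is dual to the shuffle coproduct, the result is the
  coefficient of \<open>u \<otimes> v\<close> in the summand \<open>n = k + 1\<close> of the right-hand side; the other summands
  have no term whose second component has length \<open>k\<close>.  Homogeneity of the extended product makes
  the dual maps well defined: only finitely many pairs of words have a given total degree.
\<close>

section \<open>Words as a basis: coefficients, scalars and linear extension\<close>

abbreviation coeff :: "('k \<Rightarrow>\<^sub>0 rat) \<Rightarrow> 'k \<Rightarrow> rat" where
  "coeff \<equiv> Poly_Mapping.lookup"

lemma coeff_word: "coeff (word k) l = (if k = l then 1 else 0)"
  by (simp add: word_def lookup_single when_def)

lemma keys_word [simp]: "Poly_Mapping.keys (word k) = {k}"
  by (simp add: word_def)

lemma word_mult: "word u * word v = word (u + v)"
  by (simp add: word_def mult_single)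

lemma one_eq_word: "1 = word 0"
  by (simp add: word_def)

lemma one_eq_word_Nil: "(1 :: 'a free_alg) = word []"
  by (simp add: one_eq_word zero_list_def)

lemma word_append: "word (u @ v) = word u * (word v :: 'a free_alg)"
  by (simp add: word_mult plus_list_def)

lemma word_Cons: "word (a # v) = word [a] * (word v :: 'a free_alg)"
  using word_append[of "[a]" v] by simp

text \<open>Scaling by \<open>c\<close> is convolution with \<open>Poly_Mapping.single 0 c\<close>.
  The monoid of keys need not be commutative, so centrality of this element is proved by building
  \<open>p\<close> up from single terms.\<close>

lemma
  fixes p q :: "'k::monoid_add \<Rightarrow>\<^sub>0 rat"
  shows scl_mult_left: "scl c p * q = scl c (p * q)"
    and scl_mult_right: "p * scl c q = scl c (p * q)"
proof -
  have scl_eq: "scl c p = Poly_Mapping.single 0 c * p" for c and p :: "'k::monoid_add \<Rightarrow>\<^sub>0 rat"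
    by (simp add: scl_def mult_map_scale_conv_mult)
  then show "scl c p * q = scl c (p * q)"
    by (simp add: mult.assoc)
  have comm: "p * Poly_Mapping.single 0 c = Poly_Mapping.single 0 c * p"
    for p :: "'k::monoid_add \<Rightarrow>\<^sub>0 rat"
  proof (induction p rule: update_induct)
    case const
    then show ?case by simp
  next
    case (update f a b)
    have "Poly_Mapping.update a b f = f + Poly_Mapping.single a b"
      using update(1) by (intro poly_mapping_eqI)
        (auto simp: lookup_update lookup_add lookup_single in_keys_iff when_def)
    then show ?case
      using update by (simp add: algebra_simps mult_single)
  qed
  show "p * scl c q = scl c (p * q)"
    by (simp add: scl_eq comm flip: mult.assoc)
qed

text \<open>Reduces linear identities to words; multilinear ones take one nested use per
  argument.\<close>

lemma free_induct [case_names zero add]: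
  assumes "P 0" and "\<And>c k p. P p \<Longrightarrow> P (scl c (word k) + p)"
  shows "P (p :: 'k \<Rightarrow>\<^sub>0 rat)"
proof (induction p rule: update_induct)
  case const
  then show ?case by (simp add: assms)
next
  case (update f a b)
  have "Poly_Mapping.update a b f = scl b (word a) + f"
    using update(1) by (intro poly_mapping_eqI)
      (auto simp: lookup_update lookup_add coeff_word in_keys_iff when_def)
  then show ?case using update assms by simp
qed

text \<open>A common finite index set for \<open>p\<close>, \<open>q\<close> and
  \<open>p + q\<close> avoids tracking keys lost to cancellation.\<close>

lemma lin_ext_superset:
  assumes "finite S" "Poly_Mapping.keys p \<subseteq> S"
  shows "lin_ext f p = (\<Sum>k\<in>S. scl (coeff p k) (f k))"
  unfolding lin_ext_def using assms
  by (intro sum.mono_neutral_left) (auto simp: in_keys_iff)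

lemma lin_ext_0 [simp]: "lin_ext f 0 = 0"
  by (simp add: lin_ext_def)

lemma lin_ext_word [simp]: "lin_ext f (word k) = f k"
  by (simp add: lin_ext_def coeff_word)

lemma lin_ext_add: "lin_ext f (p + q) = lin_ext f p + lin_ext f q"
proof -
  let ?S = "Poly_Mapping.keys p \<union> Poly_Mapping.keys q"
  have "Poly_Mapping.keys (p + q) \<subseteq> ?S" by (rule keys_add)
  then show ?thesis
    by (simp add: lin_ext_superset[where S = ?S] lookup_add free_module.scale_left_distrib
        sum.distrib)
qed

lemma lin_ext_scl: "lin_ext f (scl c p) = scl c (lin_ext f p)"
proof -
  have "Poly_Mapping.keys (scl c p) \<subseteq> Poly_Mapping.keys p"
    by (auto simp: in_keys_iff)
  then show ?thesis
    by (simp add: lin_ext_superset[where S = "Poly_Mapping.keys p"] free_module.scale_sum_right)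
qed

lemma lin_ext_fun_add: "lin_ext (\<lambda>k. f k + g k) p = lin_ext f p + lin_ext g p"
  by (simp add: lin_ext_def free_module.scale_right_distrib sum.distrib)

lemma lin_ext_fun_scl: "lin_ext (\<lambda>k. scl c (f k)) p = scl c (lin_ext f p)"
  by (rule poly_mapping_eqI) (simp add: lin_ext_def lookup_sum sum_distrib_left algebra_simps)

lemma lin_ext_diff: "lin_ext f (p - q) = lin_ext f p - lin_ext f q"
  by (metis add_diff_cancel_right' diff_add_cancel lin_ext_add)

lemma lin_ext_sum_list: "lin_ext f (\<Sum>x\<leftarrow>xs. g x) = (\<Sum>x\<leftarrow>xs. lin_ext f (g x))"
  by (induction xs) (simp_all add: lin_ext_add)

lemma coeff_sum_list: "coeff (\<Sum>x\<leftarrow>xs. g x) k = (\<Sum>x\<leftarrow>xs. coeff (g x) k)"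
  by (induction xs) (simp_all add: lookup_add)

lemma sum_sum_list_swap:
  fixes f :: "'i \<Rightarrow> 'j \<Rightarrow> 'b::comm_monoid_add"
  shows "(\<Sum>i\<in>S. \<Sum>x\<leftarrow>xs. f i x) = (\<Sum>x\<leftarrow>xs. \<Sum>i\<in>S. f i x)"
  by (induction xs) (simp_all add: sum.distrib)

section \<open>The tensor square and its product\<close>

lemma coeff_tensor: "coeff (A \<otimes> B) (u, v) = coeff A u * coeff B v"
proof (induction A rule: free_induct)
  case (add c k p)
  have "coeff (lin_ext (\<lambda>v. word (k, v)) B) (u, v) = (if k = u then coeff B v else 0)"
    by (induction B rule: free_induct)
      (auto simp: lin_ext_add lin_ext_scl lookup_add coeff_word)
  with add show ?case
    by (simp add: tensor_def lin_ext_add lin_ext_scl lookup_add coeff_word algebra_simps)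
qed (simp add: tensor_def)

lemma tensor_eqI: "(\<And>u v. coeff X (u, v) = coeff Y (u, v)) \<Longrightarrow> X = (Y :: 'a free_alg2)"
  by (rule poly_mapping_eqI) auto

lemma tensor_word [simp]: "word u \<otimes> word v = word (u, v)"
  by (rule tensor_eqI) (simp add: coeff_tensor coeff_word)

lemma tensor_bilinear:
  "(A + B) \<otimes> C = A \<otimes> C + B \<otimes> C" "A \<otimes> (B + C) = A \<otimes> B + A \<otimes> C"
  "(A - B) \<otimes> C = A \<otimes> C - B \<otimes> C" "A \<otimes> (B - C) = A \<otimes> B - A \<otimes> C"
  "scl c A \<otimes> C = scl c (A \<otimes> C)" "A \<otimes> scl c C = scl c (A \<otimes> C)"
  "0 \<otimes> A = 0" "A \<otimes> 0 = 0"
  by (rule tensor_eqI; simp add: coeff_tensor lookup_add lookup_minus algebra_simps)+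

lemma tensor_mult: "(A \<otimes> B) * (C \<otimes> D) = (A * C) \<otimes> (B * D)"
proof (induction A rule: free_induct)
  case (add c u A)
  have "(word u \<otimes> B) * (C \<otimes> D) = (word u * C) \<otimes> (B * D)"
  proof (induction B rule: free_induct)
    case (add c v B)
    have "(word u \<otimes> word v) * (C \<otimes> D) = (word u * C) \<otimes> (word v * D)"
    proof (induction C rule: free_induct)
      case (add c w C)
      have "(word u \<otimes> word v) * (word w \<otimes> D) = (word u * word w) \<otimes> (word v * D)"
        by (induction D rule: free_induct)
          (simp_all add: tensor_bilinear scl_mult_right distrib_left word_mult)
      with add show ?case
        by (simp add: tensor_bilinear scl_mult_right distrib_left)
    qed (simp add: tensor_bilinear)
    with add show ?case
      by (simp add: tensor_bilinear scl_mult_left distrib_right)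
  qed (simp add: tensor_bilinear)
  with add show ?case
    by (simp add: tensor_bilinear scl_mult_left distrib_right)
qed (simp add: tensor_bilinear)

section \<open>The pairing, bilinear maps and their duals\<close>

lemma pairing_superset:
  assumes "finite S" "Poly_Mapping.keys p \<subseteq> S"
  shows "pairing p q = (\<Sum>k\<in>S. coeff p k * coeff q k)"
  unfolding pairing_def using assms
  by (intro sum.mono_neutral_left) (auto simp: in_keys_iff)

lemma pairing_word_left [simp]: "pairing (word k) q = coeff q k"
  by (simp add: pairing_def coeff_word)

lemma pairing_word_right [simp]: "pairing p (word k) = coeff p k"
proof -
  have "pairing p (word k) = (\<Sum>l\<in>insert k (Poly_Mapping.keys p). coeff p l * coeff (word k) l)"
    by (rule pairing_superset) auto
  also have "\<dots> = (\<Sum>l\<in>insert k (Poly_Mapping.keys p). if l = k then coeff p l else 0)"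
    by (intro sum.cong) (auto simp: coeff_word)
  also have "\<dots> = coeff p k"
    by (subst sum.delta) auto
  finally show ?thesis .
qed

lemma pairing_0 [simp]: "pairing 0 q = 0"
  by (simp add: pairing_def)

lemma pairing_add: "pairing (p + p') q = pairing p q + pairing p' q"
proof -
  let ?S = "Poly_Mapping.keys p \<union> Poly_Mapping.keys p'"
  have "Poly_Mapping.keys (p + p') \<subseteq> ?S" by (rule keys_add)
  then show ?thesis
    by (simp add: pairing_superset[where S = ?S] lookup_add distrib_right sum.distrib)
qed

lemma pairing_scl: "pairing (scl c p) q = c * pairing p q"
proof -
  have "Poly_Mapping.keys (scl c p) \<subseteq> Poly_Mapping.keys p"
    by (auto simp: in_keys_iff)
  then show ?thesis
    by (simp add: pairing_superset[where S = "Poly_Mapping.keys p"] sum_distrib_left mult.assoc)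
qed

lemma bilinear_onD:
  assumes "bilinear_on UNIV F"
  shows "F (x + y) z = F x z + F y z" "F x (y + z) = F x y + F x z"
    "F (scl c x) z = scl c (F x z)" "F x (scl c z) = scl c (F x z)"
    "F 0 z = 0" "F x 0 = 0"
proof -
  show "F (x + y) z = F x z + F y z" "F x (y + z) = F x y + F x z"
    "F (scl c x) z = scl c (F x z)" "F x (scl c z) = scl c (F x z)"
    using assms by (simp_all add: bilinear_on_def)
  have "F (0 + 0) z = F 0 z + F 0 z" "F x (0 + 0) = F x 0 + F x 0"
    using assms unfolding bilinear_on_def by blast+
  then show "F 0 z = 0" "F x 0 = 0" by simp_all
qed

lemma tensor_lift_add: "tensor_lift F (X + Y) = tensor_lift F X + tensor_lift F Y"
  and tensor_lift_scl: "tensor_lift F (scl c X) = scl c (tensor_lift F X)"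
  by (simp_all add: tensor_lift_def lin_ext_add lin_ext_scl)

lemma tensor_lift_tensor:
  assumes "bilinear_on UNIV F"
  shows "tensor_lift F (A \<otimes> B) = F A B"
proof (induction A rule: free_induct)
  case (add c u A)
  have "tensor_lift F (word u \<otimes> B) = F (word u) B"
    by (induction B rule: free_induct)
      (simp_all add: tensor_lift_def lin_ext_add lin_ext_scl tensor_bilinear bilinear_onD[OF assms])
  with add show ?case
    by (simp add: tensor_lift_add tensor_lift_scl tensor_bilinear bilinear_onD[OF assms])
qed (simp add: tensor_lift_def tensor_bilinear bilinear_onD[OF assms])

text \<open>Bilinearity spreads the adjoint identity from pairs of words to all arguments.
  Uniqueness holds because testing on \<open>word u\<close> and \<open>word v\<close> reads off the
  coefficient at \<open>(u, v)\<close>.\<close>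

lemma dual_coprod_word_eqI:
  assumes "\<And>u v. coeff (F (word u) (word v)) C = coeff X (u, v)" and "bilinear_on UNIV F"
  shows "dual_coprod F (word C) = X"
  unfolding dual_coprod_def
proof (rule the_equality)
  have "pairing (F A B) (word C) = pairing (A \<otimes> B) X" for A B
  proof (induction A rule: free_induct)
    case (add c u A)
    have "pairing (F (word u) B) (word C) = pairing (word u \<otimes> B) X"
      by (induction B rule: free_induct)
        (simp_all add: bilinear_onD[OF assms(2)] tensor_bilinear pairing_add pairing_scl assms(1)
          lookup_add)
    with add show ?case
      by (simp add: bilinear_onD[OF assms(2)] tensor_bilinear pairing_add pairing_scl lookup_add)
  qed (simp add: bilinear_onD[OF assms(2)] tensor_bilinear)
  then show "\<forall>A B. pairing (F A B) (word C) = pairing (A \<otimes> B) X" by blast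
next
  fix Y assume "\<forall>A B. pairing (F A B) (word C) = pairing (A \<otimes> B) Y"
  from this[rule_format, of "word _" "word _"] show "Y = X"
    using assms(1) by (intro tensor_eqI) simp
qed

section \<open>Shuffle coproduct and shuffle product on words\<close>

text \<open>All ways to distribute the letters of a word over two subsequences. A list keeps
  repeated pairs, whose multiplicity is a coefficient of the shuffle coproduct.\<close>

fun unshuffles :: "'a list \<Rightarrow> ('a list \<times> 'a list) list" where
  "unshuffles [] = [([], [])]"
| "unshuffles (a # u) =
     map (\<lambda>(p, q). (a # p, q)) (unshuffles u) @ map (\<lambda>(p, q). (p, a # q)) (unshuffles u)"

lemma coprod_word_Cons:
  "coprod (word (a # u)) = (word [a] \<otimes> 1 + 1 \<otimes> word [a]) * coprod (word u)"
  by (simp add: coprod_def)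

lemma coprod_word: "coprod (word u) = (\<Sum>(p, q)\<leftarrow>unshuffles u. word (p, q))"
proof (induction u)
  case Nil
  then show ?case by (simp add: coprod_def one_eq_word zero_prod_def zero_list_def)
next
  case (Cons a u)
  have "word ([a], []) * (\<Sum>(p, q)\<leftarrow>us. word (p, q)) = (\<Sum>(p, q)\<leftarrow>us. word (a # p, q))"
    "word ([], [a]) * (\<Sum>(p, q)\<leftarrow>us. word (p, q)) = (\<Sum>(p, q)\<leftarrow>us. word (p, a # q))"
    for us :: "('a list \<times> 'a list) list"
    by (induction us) (auto simp: distrib_left word_mult plus_list_def)
  then show ?case
    by (simp add: coprod_word_Cons Cons one_eq_word_Nil distrib_right comp_def case_prod_unfold)
qed

lemma tensor_lift_coprod_word:
  "tensor_lift F (coprod (word u)) = (\<Sum>(p, q)\<leftarrow>unshuffles u. F (word p) (word q))"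
  by (simp add: tensor_lift_def coprod_word case_prod_unfold lin_ext_sum_list)

text \<open>Coassociativity of the shuffle coproduct: both sides distribute the letters over three
  words. \<open>f\<close> is arbitrary so that the induction hypothesis applies with the head letter
  prefixed to each argument in turn.\<close>

lemma unshuffles_coassoc:
  fixes f :: "'a list \<Rightarrow> 'a list \<Rightarrow> 'a list \<Rightarrow> 'b::comm_monoid_add"
  shows "(\<Sum>(p, q)\<leftarrow>unshuffles u. \<Sum>(r, s)\<leftarrow>unshuffles q. f p r s) =
    (\<Sum>(q, s)\<leftarrow>unshuffles u. \<Sum>(p, r)\<leftarrow>unshuffles q. f p r s)"
proof (induction u arbitrary: f)
  case (Cons a u)
  show ?case
    using Cons[of "\<lambda>p r s. f (a # p) r s"] Cons[of "\<lambda>p r s. f p (a # r) s"]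
      Cons[of "\<lambda>p r s. f p r (a # s)"]
    by (simp add: case_prod_unfold comp_def sum_list_addf ac_simps)
qed simp

text \<open>Each letter lands in exactly one part. The constant weight 1 gives the corresponding
  identity for lengths.\<close>

lemma sum_list_deg_unshuffles:
  assumes "(p, q) \<in> set (unshuffles u)"
  shows "sum_list (map deg p) + sum_list (map deg q) = (sum_list (map deg u) :: nat)"
  using assms
proof (induction u arbitrary: p q)
  case (Cons a u)
  from Cons.prems obtain p' q' where "(p', q') \<in> set (unshuffles u)"
    "p = a # p' \<and> q = q' \<or> p = p' \<and> q = a # q'"
    by auto
  with Cons.IH[of p' q'] show ?case by auto
qed simp

text \<open>Counit law: exactly one unshuffle sends every letter to the left.\<close>

lemma sum_unshuffles_Nil_right:
  fixes f :: "'a list \<Rightarrow> 'b::comm_monoid_add"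
  shows "(\<Sum>(p, q)\<leftarrow>unshuffles u. if q = [] then f p else 0) = f u"
proof (induction u arbitrary: f)
  case (Cons a u)
  show ?case using Cons[of "\<lambda>p. f (a # p)"]
    by (simp add: case_prod_unfold comp_def cong: if_cong)
qed simp

lemma sum_unshuffles_Nil_left:
  fixes f :: "'a list \<Rightarrow> 'b::comm_monoid_add"
  shows "(\<Sum>(p, q)\<leftarrow>unshuffles u. if p = [] then f q else 0) = f u"
proof (induction u arbitrary: f)
  case (Cons a u)
  show ?case using Cons[of "\<lambda>q. f (a # q)"]
    by (simp add: case_prod_unfold comp_def cong: if_cong)
qed simp

lemma coeff_word_mult:
  "coeff (word [a] * P) [] = 0"
  "coeff (word [a] * P) (b # u) = (if a = b then coeff P u else 0)"
  by (induction P rule: free_induct;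
      simp add: distrib_left scl_mult_right lookup_add word_mult plus_list_def coeff_word)+

text \<open>Duality of shuffle product and shuffle coproduct: the head of \<open>u\<close> comes
  from one of the two arguments, matching the two places where \<open>unshuffles\<close> can put
  it.\<close>

lemma coeff_shuffle_words:
  "coeff (shuffle_words p q) u = (\<Sum>(p', q')\<leftarrow>unshuffles u. if p' = p \<and> q' = q then 1 else 0)"
proof (induction p q arbitrary: u rule: shuffle_words.induct)
  case (1 v)
  show ?case using sum_unshuffles_Nil_left[where f = "\<lambda>q. if q = v then 1 else 0" and u = u]
    by (auto simp: coeff_word case_prod_unfold if_if_eq_conj cong: if_cong)
next
  case (2 a v)
  show ?case
    using sum_unshuffles_Nil_right[where f = "\<lambda>q. if q = a # v then 1 else 0" and u = u]
    by (auto simp: coeff_word case_prod_unfold if_if_eq_conj conj_commute cong: if_cong)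
next
  case (3 x p y q)
  show ?case
  proof (cases u)
    case Nil
    then show ?thesis by (simp add: lookup_add coeff_word_mult)
  next
    case (Cons b u')
    have "coeff (shuffle_words (x # p) (y # q)) u =
      (if x = b then coeff (shuffle_words p (y # q)) u' else 0) +
      (if y = b then coeff (shuffle_words (x # p) q) u' else 0)"
      by (simp add: lookup_add coeff_word_mult Cons)
    then show ?thesis unfolding 3
      by (auto simp: Cons case_prod_unfold comp_def cong: if_cong)
  qed
qed

text \<open>Concatenation is dual to deconcatenation, with one term per cut point
  \<open>i\<close>.\<close>

lemma coeff_mult:
  fixes X Y :: "'a free_alg"
  shows "coeff (X * Y) w = (\<Sum>i\<le>length w. coeff X (take i w) * coeff Y (drop i w))"
proof (induction X rule: free_induct)
  case (add c u X)
  have "coeff (word u * Y) w = (\<Sum>i\<le>length w. coeff (word u) (take i w) * coeff Y (drop i w))"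
  proof (induction Y rule: free_induct)
    case (add c v Y)
    \<comment> \<open>Only the cut at \<open>length u\<close> can return the pair
      \<open>(u, v)\<close>, so the sum over \<open>i\<close> has at most one nonzero term.\<close>
    have iff: "u = take i w \<and> v = drop i w \<longleftrightarrow> i = length u \<and> u @ v = w" if "i \<le> length w" for i
      using that by (auto simp: min_def)
    have "coeff (word u) (take i w) * coeff (word v) (drop i w) =
      (if i = length u then if u @ v = w then 1 else 0 else 0)" if "i \<le> length w" for i
    proof -
      have "coeff (word u) (take i w) * coeff (word v) (drop i w) =
          (if u = take i w \<and> v = drop i w then 1 else 0)"
        by (simp add: coeff_word)
      then show ?thesis
        unfolding iff[OF that] by simp
    qed
    then have "(\<Sum>i\<le>length w. coeff (word u) (take i w) * coeff (word v) (drop i w)) =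
      (\<Sum>i\<le>length w. if i = length u then if u @ v = w then 1 else 0 else 0)"
      by (intro sum.cong) simp_all
    also have "\<dots> = coeff (word u * word v) w"
      by (auto simp: word_mult plus_list_def coeff_word)
    finally show ?case using add
      by (simp add: distrib_left scl_mult_right lookup_add sum.distrib mult.left_commute
          flip: sum_distrib_left)
  qed simp
  then show ?case using add
    by (simp add: distrib_right scl_mult_left lookup_add sum.distrib sum_distrib_left
        algebra_simps)
qed simp

text \<open>Combines both dualities: the first component is unshuffled, the second is cut.
  Bilinearity reduces the claim to words.\<close>

lemma coeff_shuffle_bullet:
  "coeff (shuffle_bullet X Y) (u, v) = (\<Sum>(p, q)\<leftarrow>unshuffles u. \<Sum>i\<le>length v.
    coeff X (p, take i v) * coeff Y (q, drop i v))"
proof (induction X rule: free_induct)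
  case (add c k X)
  obtain r s where k: "k = (r, s)" by fastforce
  have "coeff (shuffle_bullet (word k) Y) (u, v) =
    (\<Sum>(p, q)\<leftarrow>unshuffles u. \<Sum>i\<le>length v. coeff (word k) (p, take i v) * coeff Y (q, drop i v))"
  proof (induction Y rule: free_induct)
    case (add c l Y)
    obtain r' s' where l: "l = (r', s')" by fastforce
    have "coeff (shuffle_bullet (word k) (word l)) (u, v) =
      coeff (shuffle_words r r') u * coeff (word s * word s') v"
      by (simp add: shuffle_bullet_def shuffle_def k l coeff_tensor)
    also have "\<dots> = (\<Sum>(p, q)\<leftarrow>unshuffles u. \<Sum>i\<le>length v.
      coeff (word k) (p, take i v) * coeff (word l) (q, drop i v))"
      by (auto simp: coeff_shuffle_words coeff_mult case_prod_unfold coeff_word k l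
          simp flip: sum_list_mult_const intro!: arg_cong[of _ _ sum_list])
    finally show ?case using add
      by (simp add: shuffle_bullet_def lin_ext_add lin_ext_scl lookup_add case_prod_unfold
          distrib_left sum.distrib sum_list_addf sum_distrib_left
          flip: sum_list_const_mult) (simp add: algebra_simps)
  qed (simp add: shuffle_bullet_def case_prod_unfold)
  then show ?case using add
    by (simp add: shuffle_bullet_def lin_ext_add lin_ext_scl lookup_add case_prod_unfold
          distrib_right sum.distrib sum_list_addf sum_distrib_left
          flip: sum_list_const_mult) (simp add: algebra_simps)
qed (simp add: shuffle_bullet_def case_prod_unfold)

section \<open>The coproduct as an algebra morphism, and primitive elements\<close>

lemma coprod_mult: "coprod (A * B) = coprod A * coprod B"
proof (induction A rule: free_induct)
  case (add c u A)
  have "coprod (word u * B) = coprod (word u) * coprod B"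
    by (induction B rule: free_induct)
      (simp_all add: coprod_def lin_ext_add lin_ext_scl distrib_left scl_mult_right word_mult
        plus_list_def)
  with add show ?case
    by (simp add: coprod_def lin_ext_add lin_ext_scl distrib_right scl_mult_left)
qed (simp add: coprod_def)

text \<open>In the bracket case the mixed terms \<open>x \<otimes> y\<close> and
  \<open>y \<otimes> x\<close> occur in both products of coproducts and cancel in the
  commutator.\<close>

lemma Lie_primitive: "x \<in> Lie \<Longrightarrow> coprod x = x \<otimes> 1 + 1 \<otimes> x"
proof (induction rule: Lie.induct)
  case (letter a)
  then show ?case by (simp add: coprod_def)
next
  case (bracket x y)
  have "coprod (comm x y) = coprod x * coprod y - coprod y * coprod x"
    by (simp add: comm_def coprod_mult lin_ext_diff flip: coprod_mult)
      (simp add: coprod_def lin_ext_diff)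
  then show ?case
    by (simp add: bracket.IH tensor_mult distrib_left distrib_right tensor_bilinear comm_def)
qed (simp_all add: coprod_def lin_ext_add lin_ext_scl tensor_bilinear
      free_module.scale_right_distrib)

lemma bilinear_grossman_larson:
  assumes "bilinear_on UNIV T"
  shows "bilinear_on UNIV (grossman_larson T)"
  by (simp add: bilinear_on_def grossman_larson_def coprod_def tensor_lift_def lin_ext_add
      lin_ext_scl bilinear_onD[OF assms] distrib_left scl_mult_right case_prod_unfold
      lin_ext_fun_add lin_ext_fun_scl)

section \<open>Homogeneous elements and products of Lie elements\<close>

lemma homogeneous_0 [simp]: "homogeneous deg n 0"
  by (simp add: homogeneous_def)

lemma homogeneous_one [simp]: "homogeneous deg 0 1"
  by (simp add: homogeneous_def one_eq_word_Nil)

lemma homogeneous_word: "homogeneous deg (sum_list (map deg w)) (word w)"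
  by (simp add: homogeneous_def)

lemma homogeneous_add:
  "homogeneous deg n p \<Longrightarrow> homogeneous deg n q \<Longrightarrow> homogeneous deg n (p + q)"
  using keys_add[of p q] by (auto simp: homogeneous_def)

lemma homogeneous_diff:
  "homogeneous deg n p \<Longrightarrow> homogeneous deg n q \<Longrightarrow> homogeneous deg n (p - q)"
  by (fastforce simp: homogeneous_def in_keys_iff lookup_minus)

lemma homogeneous_mult:
  "homogeneous deg m p \<Longrightarrow> homogeneous deg n q \<Longrightarrow> homogeneous deg (m + n) (p * q)"
  using keys_mult[of p q] by (fastforce simp: homogeneous_def plus_list_def)

lemma homogeneous_sum_list:
  "(\<And>x. x \<in> set xs \<Longrightarrow> homogeneous deg n (f x)) \<Longrightarrow> homogeneous deg n (\<Sum>x\<leftarrow>xs. f x)"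
  by (induction xs) (auto intro: homogeneous_add)

text \<open>
  Words of length \<open>k\<close> are not preserved by the action of Lie elements, but sums of products of \<open>k\<close>
  Lie elements are, so that the recursion for \<open>x * A \<triangleright> y\<close> can be followed by induction on \<open>k\<close>.
\<close>

inductive lie_product :: "('a \<Rightarrow> nat) \<Rightarrow> nat \<Rightarrow> nat \<Rightarrow> 'a free_alg \<Rightarrow> bool"
  for deg :: "'a \<Rightarrow> nat" where
  one: "lie_product deg 0 0 1"
| mult: "x \<in> Lie \<Longrightarrow> homogeneous deg m x \<Longrightarrow> lie_product deg k n P \<Longrightarrow> d = m + n \<Longrightarrow>
    lie_product deg (Suc k) d (x * P)"
| zero: "lie_product deg k n 0"
| add: "lie_product deg k n P \<Longrightarrow> lie_product deg k n Q \<Longrightarrow> lie_product deg k n (P + Q)"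

lemma lie_product_word: "lie_product deg (length w) (sum_list (map deg w)) (word w)"
proof (induction w)
  case Nil
  then show ?case by (simp add: lie_product.one flip: one_eq_word_Nil)
next
  case (Cons a w)
  show ?case
    using lie_product.mult[OF Lie.letter[of a] homogeneous_word[of deg "[a]"] Cons refl]
    by (simp add: word_mult plus_list_def)
qed

section \<open>Homogeneity of the extended product\<close>

locale homogeneous_post_lie =
  fixes deg :: "'a \<Rightarrow> nat"
    and tri T :: "'a free_alg \<Rightarrow> 'a free_alg \<Rightarrow> 'a free_alg"
  assumes deg_pos: "deg a \<ge> 1"
    and finite_deg: "finite {a. deg a = n}"
    and post_lie: "post_lie_algebra Lie comm tri"
    and homog_tri: "homogeneous_product_on deg Lie tri"
    and extension: "post_lie_extension tri T"
begin

lemma T_bilinear: "bilinear_on UNIV T"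
  using extension by (simp add: post_lie_extension_def)

lemmas T_simps = bilinear_onD[OF T_bilinear]

lemma T_one_left: "T 1 A = A"
  using extension by (simp add: post_lie_extension_def)

lemma T_Lie_mult: "x \<in> Lie \<Longrightarrow> y \<in> Lie \<Longrightarrow> T (x * A) y = T x (T A y) - T (T x A) y"
  using extension by (simp add: post_lie_extension_def)

lemma T_mult: "T A (B * C) = tensor_lift (\<lambda>P Q. T P B * T Q C) (coprod A)"
  using extension by (simp add: post_lie_extension_def)

lemma T_word_mult:
  "T (word u) (B * C) = (\<Sum>(p, q)\<leftarrow>unshuffles u. T (word p) B * T (word q) C)"
  by (simp add: T_mult tensor_lift_coprod_word)

lemma T_Lie_closed: "x \<in> Lie \<Longrightarrow> y \<in> Lie \<Longrightarrow> T x y \<in> Lie"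
  using extension post_lie
  by (simp add: post_lie_extension_def post_lie_algebra_def bilinear_on_def)

lemma T_Lie_homogeneous:
  "x \<in> Lie \<Longrightarrow> y \<in> Lie \<Longrightarrow> homogeneous deg m x \<Longrightarrow> homogeneous deg n y \<Longrightarrow>
    homogeneous deg (m + n) (T x y)"
  using extension homog_tri by (simp add: post_lie_extension_def homogeneous_product_on_def)

text \<open>\<open>x\<close> is primitive, so the Sweedler sum has two terms, and \<open>1\<close>
  acts as the identity.\<close>

lemma T_Lie_derivation:
  assumes "x \<in> Lie"
  shows "T x (B * C) = T x B * C + B * T x C"
proof -
  have "bilinear_on UNIV (\<lambda>P Q. T P B * T Q C)"
    by (simp add: bilinear_on_def T_simps algebra_simps scl_mult_left scl_mult_right)
  then show ?thesis
    by (simp add: T_mult Lie_primitive[OF assms] tensor_lift_add tensor_lift_tensor T_one_left)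
qed

text \<open>The rules give \<open>T x 1 = 0\<close> for Lie elements only. For nonempty words,
  \<open>T (word u) (1 * 1)\<close> is expanded instead.\<close>

lemma T_word_one: "T (word u) 1 = (if u = [] then 1 else 0)"
proof (induction "length u" arbitrary: u rule: less_induct)
  case less
  show ?case
  proof (cases "u = []")
    case True
    then show ?thesis by (simp add: T_one_left flip: one_eq_word_Nil)
  next
    case False
    \<comment> \<open>If both parts are nonempty, they are shorter than \<open>u\<close> and the
      induction hypothesis makes the product vanish.\<close>
    have split: "T (word p) 1 * T (word q) 1 =
        (if q = [] then T (word p) 1 else 0) + (if p = [] then T (word q) 1 else 0)"
      if "(p, q) \<in> set (unshuffles u)" for p q
    proof -
      have len: "length p + length q = length u"
        using sum_list_deg_unshuffles[OF that, of "\<lambda>_. 1"] by (simp add: sum_list_triv)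
      have Nil: "T (word []) 1 = 1" by (simp add: T_one_left flip: one_eq_word_Nil)
      show ?thesis
      proof (cases "p = [] \<or> q = []")
        case True
        then show ?thesis using len False Nil by auto
      next
        case pq: False
        then have "length p < length u" using len by (cases q) auto
        from less[OF this] pq show ?thesis by simp
      qed
    qed
    have "T (word u) 1 = (\<Sum>(p, q)\<leftarrow>unshuffles u. T (word p) 1 * T (word q) 1)"
      using T_word_mult[of u 1 1] by simp
    also have "\<dots> = (\<Sum>(p, q)\<leftarrow>unshuffles u.
        (if q = [] then T (word p) 1 else 0) + (if p = [] then T (word q) 1 else 0))"
      by (intro arg_cong[of _ _ sum_list] map_cong) (auto simp del: if_split simp: split)
    \<comment> \<open>The two extreme unshuffles each return \<open>T (word u) 1\<close>, and a
      value equal to its own double is zero.\<close>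
    also have "\<dots> = T (word u) 1 + T (word u) 1"
      using sum_unshuffles_Nil_right[of "\<lambda>p. T (word p) 1" u]
        sum_unshuffles_Nil_left[of "\<lambda>p. T (word p) 1" u]
      by (simp add: case_prod_unfold sum_list_addf)
    finally show ?thesis using False by simp
  qed
qed

text \<open>A derivation replaces one factor \<open>y\<close> at a time by the Lie element
  \<open>T x y\<close>, so the number \<open>k\<close> of factors is kept.\<close>

lemma lie_product_T:
  assumes "lie_product deg k n P" "x \<in> Lie" "homogeneous deg m x"
  shows "lie_product deg k (m + n) (T x P)"
  using assms(1)
proof induction
  case one
  then show ?case using extension assms(2)
    by (simp add: post_lie_extension_def lie_product.zero)
next
  case (mult y m' k n P d)
  have "lie_product deg (Suc k) (m + d) (T x y * P)"
    using mult T_Lie_closed T_Lie_homogeneous assms(2,3)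
    by (intro lie_product.mult[where m = "m + m'" and n = n]) auto
  moreover have "lie_product deg (Suc k) (m + d) (y * T x P)"
    using mult by (intro lie_product.mult[where m = m' and n = "m + n"]) auto
  ultimately show ?case
    using assms(2) by (simp add: T_Lie_derivation lie_product.add)
qed (auto simp: T_simps intro: lie_product.intros)

text \<open>In \<open>T (x * P) y = T x (T P y) - T (T x P) y\<close> both \<open>P\<close> and
  \<open>T x P\<close> have \<open>k\<close> factors, so induction on \<open>k\<close> works once
  \<open>P\<close> is generalised. Membership in \<open>Lie\<close> is carried along because
  homogeneity of \<open>tri\<close> is assumed only there.\<close>

lemma T_lie_product:
  assumes "lie_product deg k n P" "y \<in> Lie" "homogeneous deg m y"
  shows "T P y \<in> Lie \<and> homogeneous deg (n + m) (T P y)"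
  using assms
proof (induction k arbitrary: n P y m)
  case 0
  from this(1) show ?case
  proof (induction "0::nat" n P)
    case one
    then show ?case using 0 by (simp add: T_one_left)
  qed (auto simp: T_simps intro: Lie.intros homogeneous_add)
next
  case (Suc k)
  from Suc.prems(1) show ?case
  proof (induction "Suc k" n P)
    case (mult x m' n P d)
    from mult have P: "lie_product deg k n P" by simp
    have "T x (T P y) \<in> Lie" "homogeneous deg (d + m) (T x (T P y))"
      using Suc.IH[OF P Suc.prems(2,3)] mult T_Lie_closed
        T_Lie_homogeneous[of x "T P y" m' "n + m"]
      by (simp_all add: add.assoc)
    moreover have "T (T x P) y \<in> Lie" "homogeneous deg (d + m) (T (T x P) y)"
      using Suc.IH[OF lie_product_T[OF P] Suc.prems(2,3)] mult by simp_all
    ultimately have "T x (T P y) - T (T x P) y \<in> Lie"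
      "homogeneous deg (d + m) (T x (T P y) - T (T x P) y)"
      using Lie.add[OF _ Lie.scale[of _ "-1"]] by (auto simp: homogeneous_diff)
    then show ?case
      using mult Suc.prems(2) by (simp add: T_Lie_mult)
  qed (use Suc.prems in \<open>auto simp: T_simps intro: Lie.intros homogeneous_add\<close>)
qed

text \<open>\<open>T_word_mult\<close> peels letters off \<open>v\<close>; each piece
  \<open>T (word p) (word [a])\<close> falls under \<open>T_lie_product\<close>, a letter being a
  Lie element.\<close>

lemma T_words_homogeneous:
  "homogeneous deg (sum_list (map deg u) + sum_list (map deg v)) (T (word u) (word v))"
proof (induction v arbitrary: u)
  case Nil
  then show ?case by (simp add: T_word_one flip: one_eq_word_Nil)
next
  case (Cons a v)
  have "homogeneous deg (sum_list (map deg u) + sum_list (map deg (a # v)))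
      (T (word p) (word [a]) * T (word q) (word v))"
    if "(p, q) \<in> set (unshuffles u)" for p q
    using homogeneous_mult[OF conjunct2[OF T_lie_product[OF lie_product_word Lie.letter
            homogeneous_word[of deg "[a]"], of p]] Cons[of q]]
    by (simp add: algebra_simps flip: sum_list_deg_unshuffles[OF that, of deg])
  then show ?case
    by (auto simp: word_Cons[of a v] T_word_mult intro!: homogeneous_sum_list)
qed

section \<open>Finite support and the dual maps\<close>

lemma length_le_deg: "length w \<le> sum_list (map deg w)"
proof (induction w)
  case (Cons a w)
  then show ?case using deg_pos[of a] by simp
qed simp

text \<open>Such words have at most \<open>n\<close> letters, all from the finite set of letters of
  degree at most \<open>n\<close>.\<close>

lemma finite_bounded_words: "finite {w. sum_list (map deg w) \<le> n}"
proof (rule finite_subset)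
  have "deg a \<le> sum_list (map deg w)" if "a \<in> set w" for a w
    using that by (simp add: member_le_sum_list)
  then show "{w. sum_list (map deg w) \<le> n} \<subseteq>
      {w. set w \<subseteq> (\<Union>i\<le>n. {a. deg a = i}) \<and> length w \<le> n}"
    using length_le_deg by (fastforce intro: order_trans)
  show "finite {w. set w \<subseteq> (\<Union>i\<le>n. {a. deg a = i}) \<and> length w \<le> n}"
    by (rule finite_lists_length_le) (simp add: finite_deg)
qed

text \<open>By homogeneity, \<open>C\<close> can occur only if the degrees of \<open>u\<close> and
  \<open>v\<close> add up to that of \<open>C\<close>.\<close>

lemma finite_T_support: "finite {(u, v). coeff (T (word u) (word v)) C \<noteq> 0}"
proof (rule finite_subset)
  let ?W = "{w. sum_list (map deg w) \<le> sum_list (map deg C)}"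
  show "{(u, v). coeff (T (word u) (word v)) C \<noteq> 0} \<subseteq> ?W \<times> ?W"
    using T_words_homogeneous by (fastforce simp: homogeneous_def in_keys_iff)
  show "finite (?W \<times> ?W)"
    by (simp add: finite_bounded_words)
qed

text \<open>Finite support lets \<open>Abs_poly_mapping\<close> assemble these coefficients into a
  tensor, which witnesses the definite description in \<open>dual_coprod\<close>.\<close>

lemma coeff_cotriangle: "coeff (cotriangle T (word C)) (u, v) = coeff (T (word u) (word v)) C"
proof -
  define X where "X = Abs_poly_mapping (\<lambda>(u, v). coeff (T (word u) (word v)) C)"
  have X: "coeff X (u, v) = coeff (T (word u) (word v)) C" for u v
    unfolding X_def using finite_T_support[of C]
    by (subst lookup_Abs_poly_mapping) (simp_all add: case_prod_unfold)
  then have "cotriangle T (word C) = X"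
    unfolding cotriangle_def by (intro dual_coprod_word_eqI T_bilinear) simp
  then show ?thesis by (simp add: X)
qed

lemma coeff_cotriangle_irr:
  "coeff (cotriangle_irr T (word C)) (u, v) =
    (if length v = 1 then coeff (T (word u) (word v)) C else 0)"
proof -
  define f where "f = (\<lambda>(w, a). scl (coeff (T (word w) (word [a])) C) (word (w, [a])))"
  define S where "S = {(w, a). coeff (T (word w) (word [a])) C \<noteq> 0}"
  \<comment> \<open>Finiteness of \<open>S\<close>, needed to evaluate \<open>Sum_any\<close>,
    transfers along the injection of letters as one-letter words.\<close>
  have S: "S = (\<lambda>(w, a). (w, [a])) -` {(u, v). coeff (T (word u) (word v)) C \<noteq> 0}"
    by (auto simp: S_def)
  have "finite S"
    unfolding S by (rule finite_vimageI[OF finite_T_support]) (auto simp: inj_def)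
  have "cotriangle_irr T (word C) = Sum_any f"
    unfolding cotriangle_irr_def f_def by (simp add: coeff_cotriangle)
  also have "\<dots> = sum f S"
    by (rule Sum_any.expand_superset) (use \<open>finite S\<close> in \<open>auto simp: f_def S_def\<close>)
  finally have eq: "coeff (cotriangle_irr T (word C)) (u, v) =
      (\<Sum>x\<in>S. coeff (f x) (u, v))"
    by (simp add: lookup_sum)
  show ?thesis
  proof (cases "\<exists>a. v = [a]")
    case True
    then obtain a where v: "v = [a]" by blast
    have "(\<Sum>x\<in>S. coeff (f x) (u, v)) = (\<Sum>x\<in>S. if x = (u, a) then coeff (f x) (u, v) else 0)"
      by (intro sum.cong) (auto simp: f_def v coeff_word split: if_splits)
    also have "\<dots> = coeff (T (word u) (word v)) C"
      using \<open>finite S\<close> by (auto simp: sum.delta f_def v coeff_word S_def)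
    finally show ?thesis using eq by (simp add: v)
  next
    case False
    then have "(\<Sum>x\<in>S. coeff (f x) (u, v)) = 0"
      by (intro sum.neutral) (auto simp: f_def coeff_word)
    with False show ?thesis by (auto simp: eq length_Suc_conv)
  qed
qed

section \<open>The Grossman-Larson product on words\<close>

lemma grossman_larson_word:
  "grossman_larson T (word u) B = (\<Sum>(p, q)\<leftarrow>unshuffles u. word p * T (word q) B)"
  by (simp add: grossman_larson_def tensor_lift_coprod_word)

text \<open>Only the unshuffle with empty right part survives, as nonempty words annihilate
  \<open>1\<close>.\<close>

lemma grossman_larson_one: "grossman_larson T (word u) 1 = word u"
  using sum_unshuffles_Nil_right[where f = word and u = u]
  by (simp add: grossman_larson_word T_word_one if_distrib[of "\<lambda>x. _ * x"] cong: if_cong)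

text \<open>Follows by coassociativity. With \<open>C\<close> a letter this is the recursion that
  strips the last letter of the right argument.\<close>

lemma grossman_larson_mult:
  "grossman_larson T (word u) (B * C) =
    (\<Sum>(p, q)\<leftarrow>unshuffles u. grossman_larson T (word p) B * T (word q) C)"
  using unshuffles_coassoc[of "\<lambda>p r s. word p * T (word r) B * T (word s) C" u]
  by (simp add: grossman_larson_word T_word_mult case_prod_unfold mult.assoc
      flip: sum_list_const_mult sum_list_mult_const)

lemma grossman_larson_words_homogeneous:
  "homogeneous deg (sum_list (map deg u) + sum_list (map deg v))
    (grossman_larson T (word u) (word v))"
  unfolding grossman_larson_word
proof (rule homogeneous_sum_list)
  fix x assume x: "x \<in> set (unshuffles u)"
  have "homogeneous deg (sum_list (map deg u) + sum_list (map deg v))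
      (word (fst x) * T (word (snd x)) (word v))"
    using homogeneous_mult[OF homogeneous_word T_words_homogeneous, of "fst x" "snd x" v]
      sum_list_deg_unshuffles[of "fst x" "snd x" u deg] x
    by (simp add: add.assoc[symmetric])
  then show "homogeneous deg (sum_list (map deg u) + sum_list (map deg v))
      (case x of (p, q) \<Rightarrow> word p * T (word q) (word v))"
    by (simp add: case_prod_unfold)
qed

end

section \<open>Factorizations of a word\<close>

text \<open>The last factor is cut off rather than the first, since
  \<open>factorization_term\<close> folds from the left and treats the head factor
  specially.\<close>

lemma factorizations_Suc:
  "factorizations (Suc n) C =
    (\<lambda>(i, ws). ws @ [drop i C]) ` (SIGMA i:{..length C}. factorizations n (take i C))"
proof (intro equalityI subsetI)
  fix ws assume "ws \<in> factorizations (Suc n) C"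
  then obtain vs w where "ws = vs @ [w]" "length vs = n" "concat vs @ w = C"
    by (cases ws rule: rev_cases) (auto simp: factorizations_def)
  then show "ws \<in> (\<lambda>(i, ws). ws @ [drop i C]) `
      (SIGMA i:{..length C}. factorizations n (take i C))"
    by (intro image_eqI[of _ _ "(length (concat vs), vs)"]) (auto simp: factorizations_def)
qed (auto simp: factorizations_def)

lemma finite_factorizations: "finite (factorizations n C)"
proof (induction n arbitrary: C)
  case 0
  then show ?case
    by (rule finite_subset[of _ "{[]}", rotated]) (auto simp: factorizations_def)
qed (simp add: factorizations_Suc)

lemma sum_factorizations_Suc:
  "sum f (factorizations (Suc n) C) =
    (\<Sum>i\<le>length C. \<Sum>ws\<in>factorizations n (take i C). f (ws @ [drop i C]))"
proof -
  \<comment> \<open>For \<open>i \<le> length C\<close> the length of the suffix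
    \<open>drop i C\<close> determines \<open>i\<close>.\<close>
  have "inj_on (\<lambda>(i, ws). ws @ [drop i C]) (SIGMA i:{..length C}. factorizations n (take i C))"
  proof (rule inj_onI, clarsimp)
    fix i j assume "i \<le> length C" "j \<le> length C" "drop i C = drop j C"
    then show "i = j" by (metis diff_diff_cancel length_drop)
  qed
  then show ?thesis
    by (simp add: factorizations_Suc sum.reindex sum.Sigma finite_factorizations
        case_prod_unfold)
qed

lemma shuffle_bullet_sum_left: "shuffle_bullet (sum f S) Y = (\<Sum>x\<in>S. shuffle_bullet (f x) Y)"
  by (induction S rule: infinite_finite_induct) (simp_all add: shuffle_bullet_def lin_ext_add)

lemma factorization_term_snoc:
  "ws \<noteq> [] \<Longrightarrow> factorization_term T (ws @ [w]) =
    shuffle_bullet (factorization_term T ws) (cotriangle_irr T (word w))"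
  by (simp add: factorization_term_def)

section \<open>Coefficients of the factorization sums\<close>

context homogeneous_post_lie
begin

text \<open>Each reduced cotriangle adds exactly one letter to the second component, so
  \<open>Suc n\<close> factors reach only \<open>v\<close> of length \<open>n\<close>. The induction
  strips the last factor of \<open>C\<close> together with the last letter of \<open>v\<close>, as
  in \<open>grossman_larson_mult\<close>.\<close>

lemma coeff_factorization_sum:
  "coeff (\<Sum>ws\<in>factorizations (Suc n) C. factorization_term T ws) (u, v) =
    (if n = length v then coeff (grossman_larson T (word u) (word v)) C else 0)"
proof (induction n arbitrary: C u v)
  case 0
  \<comment> \<open>The only term is \<open>word C \<otimes> 1\<close>, which agrees with
    \<open>grossman_larson_one\<close> at the empty \<open>v\<close>.\<close>
  have "factorizations (Suc 0) C = {[C]}"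
    by (auto simp: factorizations_def length_Suc_conv)
  then show ?case
    using grossman_larson_one[of u]
    by (auto simp: factorization_term_def one_eq_word_Nil coeff_word)
next
  case (Suc n)
  let ?R = "\<lambda>n C. \<Sum>ws\<in>factorizations n C. factorization_term T ws"
  have "?R (Suc (Suc n)) C =
      (\<Sum>i\<le>length C. \<Sum>ws\<in>factorizations (Suc n) (take i C).
        shuffle_bullet (factorization_term T ws) (cotriangle_irr T (word (drop i C))))"
    unfolding sum_factorizations_Suc[of _ "Suc n"]
    by (intro sum.cong refl factorization_term_snoc) (auto simp: factorizations_def)
  also have "\<dots> = (\<Sum>i\<le>length C.
      shuffle_bullet (?R (Suc n) (take i C)) (cotriangle_irr T (word (drop i C))))"
    by (simp add: shuffle_bullet_sum_left)
  finally have "coeff (?R (Suc (Suc n)) C) (u, v) =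
      (\<Sum>i\<le>length C. \<Sum>(p, q)\<leftarrow>unshuffles u. \<Sum>j\<le>length v.
        (if n = length (take j v)
         then coeff (grossman_larson T (word p) (word (take j v))) (take i C) else 0) *
        (if length (drop j v) = 1 then coeff (T (word q) (word (drop j v))) (drop i C) else 0))"
    by (simp only: lookup_sum[where X = "{..length C}"] coeff_shuffle_bullet Suc coeff_cotriangle_irr)
  also have "\<dots> = (\<Sum>i\<le>length C. \<Sum>(p, q)\<leftarrow>unshuffles u. if Suc n = length v then
        coeff (grossman_larson T (word p) (word (butlast v))) (take i C) *
        coeff (T (word q) (word [last v])) (drop i C) else 0)"
  proof -
    \<comment> \<open>The prefix must have length \<open>n\<close> and the rest must be one letter,
      so only \<open>j = n\<close> survives, and only if \<open>Suc n = length v\<close>; there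
      \<open>v\<close> is nonempty and \<open>last v\<close> is meaningful.\<close>
    have "(if n = length (take j v)
         then coeff (grossman_larson T (word p) (word (take j v))) (take i C) else 0) *
        (if length (drop j v) = 1 then coeff (T (word q) (word (drop j v))) (drop i C) else 0) =
      (if j = n then if Suc n = length v then
        coeff (grossman_larson T (word p) (word (butlast v))) (take i C) *
        coeff (T (word q) (word [last v])) (drop i C) else 0 else 0)"
      if "j \<le> length v" for i j p q
    proof (cases "j = n \<and> Suc n = length v")
      case True
      then obtain w a where "v = w @ [a]" by (cases v rule: rev_cases) auto
      with True show ?thesis by simp
    next
      case False
      with that show ?thesis by auto
    qed
    then have "(\<Sum>j\<le>length v. (if n = length (take j v)
         then coeff (grossman_larson T (word p) (word (take j v))) (take i C) else 0) *
        (if length (drop j v) = 1 then coeff (T (word q) (word (drop j v))) (drop i C) else 0)) =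
      (\<Sum>j\<le>length v. if j = n then if Suc n = length v then
        coeff (grossman_larson T (word p) (word (butlast v))) (take i C) *
        coeff (T (word q) (word [last v])) (drop i C) else 0 else 0)" for i p q
      by (intro sum.cong) auto
    moreover have "(\<Sum>j\<le>length v. if j = n then if Suc n = length v then
        coeff (grossman_larson T (word p) (word (butlast v))) (take i C) *
        coeff (T (word q) (word [last v])) (drop i C) else 0 else 0) = (if Suc n = length v then
        coeff (grossman_larson T (word p) (word (butlast v))) (take i C) *
        coeff (T (word q) (word [last v])) (drop i C) else 0)" for i p q
      by (subst sum.delta) auto
    ultimately show ?thesis by (simp only:)
  qed
  also have "\<dots> = (if Suc n = length v then coeff (grossman_larson T (word u) (word v)) C else 0)"
  proof (cases "Suc n = length v")
    case True
    then have v: "word v = word (butlast v) * word [last v]"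
      by (metis append_butlast_last_id length_0_conv nat.simps(3) word_append)
    \<comment> \<open>The cuts of \<open>C\<close> come from \<open>coeff_mult\<close>, the
      unshuffles from \<open>grossman_larson_mult\<close>; the two sums only have to be
      swapped.\<close>
    show ?thesis
      by (simp add: True v grossman_larson_mult coeff_sum_list case_prod_unfold coeff_mult
          sum_sum_list_swap)
  next
    case False
    then show ?thesis by (simp add: case_prod_unfold)
  qed
  finally show ?case .
qed

end

section \<open>Summation over the number of factors\<close>

text \<open>Finiteness is part of the claim because \<open>Sum_any\<close> is 0 on infinite
  support.\<close>

theorem theorem2p4:
  fixes deg :: "'a::countable \<Rightarrow> nat"
    and tri T :: "'a free_alg \<Rightarrow> 'a free_alg \<Rightarrow> 'a free_alg"
    and A :: "'a list"
  assumes "\<And>a. deg a \<ge> 1"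
    and "\<And>n. finite {a. deg a = n}"
    and "post_lie_algebra Lie comm tri"
    and "homogeneous_product_on deg Lie tri"
    and "post_lie_extension tri T"
  shows "finite {n. n \<ge> 1 \<and> (\<Sum>ws\<in>factorizations n A. factorization_term T ws) \<noteq> 0} \<and>
    coprod_GL T (word A) =
      Sum_any (\<lambda>n. if n \<ge> 1 then \<Sum>ws\<in>factorizations n A. factorization_term T ws else 0)"
proof
  interpret homogeneous_post_lie deg tri T
    by unfold_locales (use assms in auto)
  let ?R = "\<lambda>n. \<Sum>ws\<in>factorizations n A. factorization_term T ws"
  let ?N = "sum_list (map deg A) + 1"
  \<comment> \<open>A nonzero coefficient at \<open>(u, v)\<close> forces
    \<open>n = length v + 1\<close>, and \<open>length v\<close> is at most the degree of
    \<open>v\<close>, hence at most that of \<open>A\<close>.\<close>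
  have vanish: "n \<le> ?N" if "n \<ge> 1" "?R n \<noteq> 0" for n
  proof -
    from that obtain m where n: "n = Suc m" by (cases n) auto
    from that obtain u v where "coeff (?R n) (u, v) \<noteq> 0"
      by (metis lookup_zero tensor_eqI)
    then have "m = length v" "coeff (grossman_larson T (word u) (word v)) A \<noteq> 0"
      unfolding n coeff_factorization_sum by (auto split: if_splits)
    then have "sum_list (map deg u) + sum_list (map deg v) = sum_list (map deg A)"
      using grossman_larson_words_homogeneous[of u v]
      by (auto simp: homogeneous_def in_keys_iff)
    with \<open>m = length v\<close> show ?thesis
      using length_le_deg[of v] by (simp add: n)
  qed
  then show "finite {n. n \<ge> 1 \<and> ?R n \<noteq> 0}"
    by (intro finite_subset[OF _ finite_atMost[of ?N]]) auto
  have "coeff (grossman_larson T (word u) (word v)) A =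
      coeff (Sum_any (\<lambda>n. if n \<ge> 1 then ?R n else 0)) (u, v)" for u v
  proof -
    \<comment> \<open>The index \<open>Suc (length v)\<close> may exceed \<open>?N\<close>;
      inserting it lets the single surviving term be picked out for every \<open>v\<close>.\<close>
    let ?S = "insert (Suc (length v)) {1..?N}"
    have "Sum_any (\<lambda>n. if n \<ge> 1 then ?R n else 0) = (\<Sum>n\<in>?S. if n \<ge> 1 then ?R n else 0)"
      by (rule Sum_any.expand_superset) (use vanish in \<open>auto split: if_splits\<close>)
    then have "coeff (Sum_any (\<lambda>n. if n \<ge> 1 then ?R n else 0)) (u, v) =
        (\<Sum>n\<in>?S. coeff (if n \<ge> 1 then ?R n else 0) (u, v))"
      by (simp only: lookup_sum)
    also have "\<dots> = (\<Sum>n\<in>?S. if n = Suc (length v)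
        then coeff (grossman_larson T (word u) (word v)) A else 0)"
    proof (rule sum.cong[OF refl])
      fix n assume "n \<in> ?S"
      then obtain m where n: "n = Suc m" by (cases n) auto
      show "coeff (if n \<ge> 1 then ?R n else 0) (u, v) = (if n = Suc (length v)
        then coeff (grossman_larson T (word u) (word v)) A else 0)"
        unfolding n using coeff_factorization_sum[of m A u v] by simp
    qed
    also have "\<dots> = coeff (grossman_larson T (word u) (word v)) A"
      by (subst sum.delta) auto
    finally show ?thesis ..
  qed
  then show "coprod_GL T (word A) = Sum_any (\<lambda>n. if n \<ge> 1 then ?R n else 0)"
    unfolding coprod_GL_def
    by (intro dual_coprod_word_eqI bilinear_grossman_larson T_bilinear)
qed

end
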